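(* Let $\bm{U}=\{\bm{u}[n]\}$, $\bm{V}=\{\bm{v}[n]\}_{n=1}^N$, $\bm{A}=\{\bm{a}[n]\}_{n=1}^N$ be the optimization variables, with $\bm{u}[n]=(x[n],y[n])$, $\bm{v}[n]$, $\bm{a}[n]\in\mathbb{R}^2$, and let all other quantities (including the association indicators $\rho_{k,n}$ and the reference trajectory $\bm{u}^{(l)}[n]$) be fixed as described in the context. Then the optimization problem $$\max_{\bm{U},\bm{V},\bm{A}}\ \sum_{k=1}^{K}\underline{R}_E[k]$$ subject to \begin{align*} &\underline{R}_E[k]\ge R_0,\quad k=1,\dots,K,\\ &\sum_{i=2}^{n}\overline{R}_{U_t}[i]\le\sum_{i=1}^{n-1}\underline{R}_{U_r}[i],\quad n=2,\dots,N,\\ &\bm{u}[1]=\bm{u}[N]=\bm{u}_0,\\ &\|\bm{u}[n+1]-\bm{u}[n]\|\le V_{\max}\delta_t,\quad n=1,\dots,N-1,\\ &\bm{v}[n+1]=\bm{v}[n]+\bm{a}[n]\delta_t,\quad n=1,\dots,N-1,\\ &\bm{u}[n+1]=\bm{u}[n]+\bm{v}[n]\delta_t+\tfrac12\bm{a}[n]\delta_t^2,\quad n=1,\dots,N-1,\\ &\|\bm{v}[n]\|\le V_{\max},\quad n=1,\dots,N,\\ &\|\bm{a}[n]\|\le a_{\max},\quad n=1,\dots,N, \end{align*} is a convex optimization problem.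
   Context: Setting: a UAV flying at fixed altitude $H>0$ relays data from $N_B$ ground base stations (GBSs) to $K$ cell-edge users (CEUs) over $N$ time slots of length $\delta_t=T/N$, where $T>0$ is the transmission period. $\|\cdot\|$ is the Euclidean norm. Fixed data: GBS horizontal locations $\bm{b}_m\in\mathbb{R}^2$ ($m=1,\dots,N_B$); CEU horizontal locations $\bm{e}_k=(x_k,y_k)\in\mathbb{R}^2$ ($k=1,\dots,K$); the initial and final UAV location $\bm{u}_0\in\mathbb{R}^2$; positive constants $P_B$ (GBS transmit power), $P_U$ (UAV transmit power), $\alpha_0$ (reference channel power), $\sigma^2$ (noise power), $V_{\max}$ (maximum speed), $a_{\max}$ (maximum acceleration), $R_0$ (minimum rate); small-scale fading vectors $\bm{g}_m$ of the channels from GBS $m$ (equipped with $L$ antennas) to the UAV; fixed association indicators $\rho_{k,n}\in\{0,1\}$ with $\sum_{k=1}^K\rho_{k,n}\le 1$ for every $n$ and $\rho_{k,1}=0$ for every $k$; and a fixed reference trajectory $\bm{u}^{(l)}[n]\in\mathbb{R}^2$, $n=1,\dots,N$ (the iterate from the previous iteration). The variables are the UAV horizontal positions $\bm{u}[n]=(x[n],y[n])$, velocities $\bm{v}[n]$ and accelerations $\bm{a}[n]$, for $n=1,\dots,N$ (with $\bm{u}[1],\bm{u}[N]$ fixed by the constraint $\bm{u}[1]=\bm{u}[N]=\bm{u}_0$). Definition of $\underline{R}_{U_r}[n]$ (a lower bound of the UAV receiving rate): $$\underline{R}_{U_r}[n]=\sum_{m=1}^{N_B}\Big(-a_{r,m}^{(l)}[n]\big(\|\bm{u}[n]-\bm{b}_m\|^2-\|\bm{u}^{(l)}[n]-\bm{b}_m\|^2\big)+b_{r,m}^{(l)}[n]\Big),$$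 $$a_{r,m}^{(l)}[n]=\frac{\dfrac{P_B\alpha_0\sigma^2\|\bm{g}_m\|^2}{[\sigma^2(H^2+\|\bm{u}^{(l)}[n]-\bm{b}_m\|^2)]^2}\log_2 e}{1+\dfrac{N_BP_B\alpha_0\|\bm{g}_m\|^2}{\sigma^2(H^2+\|\bm{u}^{(l)}[n]-\bm{b}_m\|^2)}},\qquad b_{r,m}^{(l)}[n]=\frac1{N_B}\log_2\!\Big(1+\frac{N_BP_B\alpha_0\|\bm{g}_m\|^2}{\sigma^2(H^2+\|\bm{u}^{(l)}[n]-\bm{b}_m\|^2)}\Big).$$ Definition of $\overline{R}_{U_t}[n]$ (an upper bound of the UAV transmitting rate): $$\overline{R}_{U_t}[n]=\sum_{k=1}^K\rho_{k,n}\,\overline{r}_k[n],$$ $$\overline{r}_k[n]=\tfrac13\log_2\!\Big(1+\frac{P_U\alpha_0}{3\sigma^2H^2}\Big)+\tfrac13\log_2\!\Big(1+\frac{P_U\alpha_0}{3\sigma^2(x[n]-x_k)^2}\Big)+\tfrac13\log_2\!\Big(1+\frac{P_U\alpha_0}{3\sigma^2(y[n]-y_k)^2}\Big).$$ Definition of $\underline{R}_E[k]$ (a lower bound of the average rate of CEU $k$): $$\underline{R}_E[k]=\frac1N\sum_{n=1}^N\rho_{k,n}\,\underline{r}_k[n],\qquad \underline{r}_k[n]=-c_k^{(l)}[n]\big(\|\bm{u}[n]-\bm{e}_k\|^2-\|\bm{u}^{(l)}[n]-\bm{e}_k\|^2\big)+d_k^{(l)}[n],$$ $$c_k^{(l)}[n]=\frac{\dfrac{P_U\alpha_0\sigma^2}{[\sigma^2(H^2+\|\bm{u}^{(l)}[n]-\bm{e}_k\|^2)]^2}\log_2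 e}{1+\dfrac{P_U\alpha_0}{\sigma^2(H^2+\|\bm{u}^{(l)}[n]-\bm{e}_k\|^2)}},\qquad d_k^{(l)}[n]=\log_2\!\Big(1+\frac{P_U\alpha_0}{\sigma^2(H^2+\|\bm{u}^{(l)}[n]-\bm{e}_k\|^2)}\Big).$$ A maximization problem is called a convex (optimization) problem if its objective is a concave function of the variables, its equality constraints are affine, and each inequality constraint is convex (of the form convex function $\le$ concave function).
   Formalization: The transmit-rate bound is undefined where x[n]=x_k or y[n]=y_k and not convex across these points; the causality constraints are therefore shown convex on every convex set of variables avoiding these points for all ρ_{k,n}=1, n≥2; everything else holds on the whole space. *)

theory Defs
  imports "HOL-Analysis.Analysis"
begin

definition affine_map :: "('a::real_vector \<Rightarrow> 'b::real_vector) \<Rightarrow> bool" where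
  "affine_map h \<longleftrightarrow> (\<exists>L c. linear L \<and> (\<forall>z. h z = L z + c))"

(* A maximization problem: a triple (S, f, g) in ineq_constraints stands for the constraint
   f z \<le> g z, whose two sides are functions with domain S; a pair (h, h') in eq_constraints
   stands for h z = h' z. The objective and the equality constraints have domain UNIV. *)
record ('a, 'b) max_problem =
  objective :: "'a \<Rightarrow> real"
  ineq_constraints :: "('a set \<times> ('a \<Rightarrow> real) \<times> ('a \<Rightarrow> real)) set"
  eq_constraints :: "(('a \<Rightarrow> 'b) \<times> ('a \<Rightarrow> 'b)) set"

(* The library's convex_on S and concave_on S include convexity of the domain S. *)
definition convex_problem :: "('a::real_vector, 'b::real_vector) max_problem \<Rightarrow> bool" where
  "convex_problem P \<longleftrightarrow>
     concave_on UNIV (objective P) \<and>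
     (\<forall>(S, f, g) \<in> ineq_constraints P. convex_on S f \<and> concave_on S g) \<and>
     (\<forall>(h, h') \<in> eq_constraints P. affine_map h \<and> affine_map h')"

(* Stations m, users k and time slots n are numbered from 1. The type 'n indexes the
   coordinates of a trajectory, so that the variables range over exactly (R^2)^N; slot
   numbers these coordinates by 1, ..., N. The type 'l indexes the antennas of a station.
   noise_power is the quantity written sigma^2. *)
record ('n, 'l) uav_data =
  num_slots :: nat
  num_stations :: nat
  num_users :: nat
  slot :: "nat \<Rightarrow> 'n"
  altitude :: real
  period :: real
  station :: "nat \<Rightarrow> real^2"
  user :: "nat \<Rightarrow> real^2"
  base_point :: "real^2"
  station_power :: real
  uav_power :: real
  ref_power :: real
  noise_power :: real
  max_speed :: real
  max_accel :: real
  min_rate :: real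
  fading :: "nat \<Rightarrow> complex^'l"
  assoc :: "nat \<Rightarrow> nat \<Rightarrow> real"
  ref_traj :: "nat \<Rightarrow> real^2"

definition valid_data :: "('n::finite, 'l::finite) uav_data \<Rightarrow> bool" where
  "valid_data p \<longleftrightarrow>
     num_slots p \<ge> 1 \<and> num_stations p \<ge> 1 \<and> num_users p \<ge> 1 \<and>
     bij_betw (slot p) {1..num_slots p} UNIV \<and>
     altitude p > 0 \<and> period p > 0 \<and>
     station_power p > 0 \<and> uav_power p > 0 \<and> ref_power p > 0 \<and> noise_power p > 0 \<and>
     max_speed p > 0 \<and> max_accel p > 0 \<and> min_rate p > 0 \<and>
     (\<forall>k\<in>{1..num_users p}. \<forall>n\<in>{1..num_slots p}. assoc p k n \<in> {0, 1}) \<and>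
     (\<forall>n\<in>{1..num_slots p}. (\<Sum>k=1..num_users p. assoc p k n) \<le> 1) \<and>
     (\<forall>k\<in>{1..num_users p}. assoc p k 1 = 0)"

definition slot_length :: "('n::finite, 'l::finite) uav_data \<Rightarrow> real" where
  "slot_length p = period p / real (num_slots p)"

type_synonym 'n vars = "((real^2)^'n) \<times> ((real^2)^'n) \<times> ((real^2)^'n)"

definition pos :: "('n::finite, 'l::finite) uav_data \<Rightarrow> nat \<Rightarrow> 'n vars \<Rightarrow> real^2" where
  "pos p n = (\<lambda>(u, v, a). u $ slot p n)"

definition vel :: "('n::finite, 'l::finite) uav_data \<Rightarrow> nat \<Rightarrow> 'n vars \<Rightarrow> real^2" where
  "vel p n = (\<lambda>(u, v, a). v $ slot p n)"

definition acc :: "('n::finite, 'l::finite) uav_data \<Rightarrow> nat \<Rightarrow> 'n vars \<Rightarrow> real^2" where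
  "acc p n = (\<lambda>(u, v, a). a $ slot p n)"

definition coef_a :: "('n::finite, 'l::finite) uav_data \<Rightarrow> nat \<Rightarrow> nat \<Rightarrow> real" where
  "coef_a p m n =
     (station_power p * ref_power p * noise_power p * (norm (fading p m))\<^sup>2
        / (noise_power p * ((altitude p)\<^sup>2 + (norm (ref_traj p n - station p m))\<^sup>2))\<^sup>2
        * log 2 (exp 1))
     / (1 + real (num_stations p) * station_power p * ref_power p * (norm (fading p m))\<^sup>2
            / (noise_power p * ((altitude p)\<^sup>2 + (norm (ref_traj p n - station p m))\<^sup>2)))"

definition coef_b :: "('n::finite, 'l::finite) uav_data \<Rightarrow> nat \<Rightarrow> nat \<Rightarrow> real" where
  "coef_b p m n =
     1 / real (num_stations p) *
     log 2 (1 + real (num_stations p) * station_power p * ref_power p * (norm (fading p m))\<^sup>2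
            / (noise_power p * ((altitude p)\<^sup>2 + (norm (ref_traj p n - station p m))\<^sup>2)))"

definition receive_rate_lb :: "('n::finite, 'l::finite) uav_data \<Rightarrow> nat \<Rightarrow> 'n vars \<Rightarrow> real" where
  "receive_rate_lb p n z =
     (\<Sum>m=1..num_stations p.
        - coef_a p m n * ((norm (pos p n z - station p m))\<^sup>2
                          - (norm (ref_traj p n - station p m))\<^sup>2)
        + coef_b p m n)"

definition transmit_rate_ub_user ::
    "('n::finite, 'l::finite) uav_data \<Rightarrow> nat \<Rightarrow> nat \<Rightarrow> 'n vars \<Rightarrow> real" where
  "transmit_rate_ub_user p k n z =
     1/3 * log 2 (1 + uav_power p * ref_power p / (3 * noise_power p * (altitude p)\<^sup>2))
   + 1/3 * log 2 (1 + uav_power p * ref_power p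
                      / (3 * noise_power p * (pos p n z $ 1 - user p k $ 1)\<^sup>2))
   + 1/3 * log 2 (1 + uav_power p * ref_power p
                      / (3 * noise_power p * (pos p n z $ 2 - user p k $ 2)\<^sup>2))"

definition transmit_rate_ub :: "('n::finite, 'l::finite) uav_data \<Rightarrow> nat \<Rightarrow> 'n vars \<Rightarrow> real" where
  "transmit_rate_ub p n z =
     (\<Sum>k=1..num_users p. assoc p k n * transmit_rate_ub_user p k n z)"

(* The points at which transmit_rate_ub p n is a genuine formula for n = 2, ..., N: no
   division by zero in a term that is actually present. This set is not convex. *)
definition rate_domain :: "('n::finite, 'l::finite) uav_data \<Rightarrow> 'n vars set" where
  "rate_domain p =
     {z. \<forall>n\<in>{2..num_slots p}. \<forall>k\<in>{1..num_users p}. assoc p k n = 1 \<longrightarrow>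
           pos p n z $ 1 \<noteq> user p k $ 1 \<and> pos p n z $ 2 \<noteq> user p k $ 2}"

definition coef_c :: "('n::finite, 'l::finite) uav_data \<Rightarrow> nat \<Rightarrow> nat \<Rightarrow> real" where
  "coef_c p k n =
     (uav_power p * ref_power p * noise_power p
        / (noise_power p * ((altitude p)\<^sup>2 + (norm (ref_traj p n - user p k))\<^sup>2))\<^sup>2
        * log 2 (exp 1))
     / (1 + uav_power p * ref_power p
            / (noise_power p * ((altitude p)\<^sup>2 + (norm (ref_traj p n - user p k))\<^sup>2)))"

definition coef_d :: "('n::finite, 'l::finite) uav_data \<Rightarrow> nat \<Rightarrow> nat \<Rightarrow> real" where
  "coef_d p k n =
     log 2 (1 + uav_power p * ref_power p
            / (noise_power p * ((altitude p)\<^sup>2 + (norm (ref_traj p n - user p k))\<^sup>2)))"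

definition user_rate_lb :: "('n::finite, 'l::finite) uav_data \<Rightarrow> nat \<Rightarrow> 'n vars \<Rightarrow> real" where
  "user_rate_lb p k z =
     1 / real (num_slots p) *
     (\<Sum>n=1..num_slots p. assoc p k n *
        (- coef_c p k n * ((norm (pos p n z - user p k))\<^sup>2
                           - (norm (ref_traj p n - user p k))\<^sup>2)
         + coef_d p k n))"

(* D is the domain of the constraints that involve the transmit rate bound, and is meant to be
   a subset of rate_domain; everything else is posed on the whole space of variables. *)
definition trajectory_problem ::
    "('n::finite, 'l::finite) uav_data \<Rightarrow> 'n vars set \<Rightarrow> ('n vars, real^2) max_problem" where
  "trajectory_problem p D =
     (let N = num_slots p; \<delta> = slot_length p in
      \<lparr> objective = (\<lambda>z. \<Sum>k=1..num_users p. user_rate_lb p k z),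
        ineq_constraints =
          (\<lambda>k. (UNIV, \<lambda>z. min_rate p, user_rate_lb p k)) ` {1..num_users p} \<union>
          (\<lambda>n. (D, \<lambda>z. \<Sum>i=2..n. transmit_rate_ub p i z,
                   \<lambda>z. \<Sum>i=1..n-1. receive_rate_lb p i z)) ` {2..N} \<union>
          (\<lambda>n. (UNIV, \<lambda>z. norm (pos p (n+1) z - pos p n z),
                      \<lambda>z. max_speed p * \<delta>)) ` {1..N-1} \<union>
          (\<lambda>n. (UNIV, \<lambda>z. norm (vel p n z), \<lambda>z. max_speed p)) ` {1..N} \<union>
          (\<lambda>n. (UNIV, \<lambda>z. norm (acc p n z), \<lambda>z. max_accel p)) ` {1..N},
        eq_constraints =
          {(pos p 1, \<lambda>z. base_point p), (pos p N, \<lambda>z. base_point p)} \<union>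
          (\<lambda>n. (vel p (n+1), \<lambda>z. vel p n z + \<delta> *\<^sub>R acc p n z)) ` {1..N-1} \<union>
          (\<lambda>n. (pos p (n+1),
                \<lambda>z. pos p n z + \<delta> *\<^sub>R vel p n z + (1/2 * \<delta>\<^sup>2) *\<^sub>R acc p n z)) ` {1..N-1}
      \<rparr>)"

end

(* The rate bounds subtracted in the objective and on the right-hand sides are nonnegative
   multiples of squared distances of affine functions of the variables. In the transmit rate
   bound, log (1 + a / (b t^2)) is convex on each of the two half-lines t < 0 and t > 0 (but
   not across 0), and a coordinate difference that does not vanish on a convex set has
   constant sign there. *)
theory Submission
  imports Defs
begin

section \<open>Affine maps and convex functions\<close>

lemma affine_map_linear: "linear h \<Longrightarrow> affine_map h"
  unfolding affine_map_def by (metis add.right_neutral)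

lemma affine_map_const: "affine_map (\<lambda>z. c)"
  unfolding affine_map_def by (metis add_0 linear_zero)

lemma affine_map_add:
  assumes "affine_map f" "affine_map g"
  shows "affine_map (\<lambda>z. f z + g z)"
proof -
  obtain L c M d where "linear L" "linear M" and "\<And>z. f z = L z + c" "\<And>z. g z = M z + d"
    using assms unfolding affine_map_def by blast
  then show ?thesis
    unfolding affine_map_def
    by (intro exI[of _ "\<lambda>z. L z + M z"] exI[of _ "c + d"]) (simp add: linear_compose_add)
qed

lemma affine_map_linear_compose:
  assumes "linear T" "affine_map f"
  shows "affine_map (\<lambda>z. T (f z))"
proof -
  obtain L c where "linear L" "\<And>z. f z = L z + c"
    using assms(2) unfolding affine_map_def by blast
  then show ?thesis
    unfolding affine_map_def using assms(1)
    by (intro exI[of _ "T \<circ> L"] exI[of _ "T c"]) (simp add: linear_compose linear_add)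
qed

lemma affine_map_scaleR: "affine_map f \<Longrightarrow> affine_map (\<lambda>z. r *\<^sub>R f z)"
  using affine_map_linear_compose[OF linear_scaleR] .

lemma affine_map_nth: "affine_map f \<Longrightarrow> affine_map (\<lambda>z. f z $ i)"
  by (rule affine_map_linear_compose) (auto intro: linearI)

lemma affine_map_diff:
  assumes "affine_map f" "affine_map g"
  shows "affine_map (\<lambda>z. f z - g z)"
  using affine_map_add[OF assms(1) affine_map_scaleR[OF assms(2), of "-1"]] by simp

text \<open>The constant part survives because weights summing to 1 split it as
  \<open>u *\<^sub>R c + v *\<^sub>R c\<close>. All transfers of convexity along affine maps rest on
  this.\<close>

lemma affine_map_convex_combination:
  assumes "affine_map h" "u + v = 1"
  shows "h (u *\<^sub>R x + v *\<^sub>R y) = u *\<^sub>R h x + v *\<^sub>R h y"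
proof -
  obtain L c where L: "linear L" and h: "\<And>z. h z = L z + c"
    using assms(1) unfolding affine_map_def by blast
  have "u *\<^sub>R c + v *\<^sub>R c = c"
    by (metis assms(2) scaleR_add_left scaleR_one)
  then show ?thesis
    by (simp add: h linear_add[OF L] linear_cmul[OF L] scaleR_add_right algebra_simps)
qed

lemma convex_affine_map_image:
  assumes "affine_map h" "convex S"
  shows "convex (h ` S)"
  unfolding convex_def
proof safe
  fix x y and u v :: real
  assume "x \<in> S" "y \<in> S" "0 \<le> u" "0 \<le> v" "u + v = 1"
  then show "u *\<^sub>R h x + v *\<^sub>R h y \<in> h ` S"
    using affine_map_convex_combination[OF assms(1)] convexD[OF assms(2)] by (metis imageI)
qed

text \<open>Convexity of \<open>f\<close> is required only on the image of \<open>S\<close>, so that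
  \<open>f\<close> may be a function such as the logarithmic term, which is convex on a half-line
  but not on the whole line.\<close>

lemma convex_on_affine_map_compose:
  assumes "convex_on (h ` S) f" "affine_map h" "convex S"
  shows "convex_on S (\<lambda>z. f (h z))"
  using assms(1,3) affine_map_convex_combination[OF assms(2)]
  unfolding convex_on_def by simp

lemma convex_on_norm_affine:
  assumes "affine_map h" "convex S"
  shows "convex_on S (\<lambda>z. norm (h z))"
  using convex_on_affine_map_compose[OF _ assms, of norm]
    convex_on_dist[OF convex_affine_map_image[OF assms], of 0] by simp

text \<open>Squaring is increasing on nonnegative numbers and convex, so it preserves convexity of
  the nonnegative function \<open>norm (h z)\<close>.\<close>

lemma convex_on_norm_affine_power2:
  assumes "affine_map h" "convex S"
  shows "convex_on S (\<lambda>z. (norm (h z))\<^sup>2)"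
  unfolding convex_on_def
proof (intro conjI ballI allI impI)
  fix x y and u v :: real
  assume *: "x \<in> S" "y \<in> S" "0 \<le> u" "0 \<le> v" "u + v = 1"
  have "norm (h (u *\<^sub>R x + v *\<^sub>R y)) \<le> u * norm (h x) + v * norm (h y)"
    using convex_on_norm_affine[OF assms] * unfolding convex_on_def by blast
  then have "(norm (h (u *\<^sub>R x + v *\<^sub>R y)))\<^sup>2 \<le> (u * norm (h x) + v * norm (h y))\<^sup>2"
    by (rule power_mono) simp
  also have "\<dots> \<le> u * (norm (h x))\<^sup>2 + v * (norm (h y))\<^sup>2"
    using convex_power2 * unfolding convex_on_def by simp
  finally show "(norm (h (u *\<^sub>R x + v *\<^sub>R y)))\<^sup>2 \<le> u * (norm (h x))\<^sup>2 + v * (norm (h y))\<^sup>2" .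
qed (rule assms(2))

lemma convex_on_sum_fun:
  assumes "convex S" "\<And>i. i \<in> I \<Longrightarrow> convex_on S (f i)"
  shows "convex_on S (\<lambda>z. \<Sum>i\<in>I. f i z)"
  using assms
\<comment> \<open>A sum over an infinite index set is 0 by convention, hence constant like the empty
  sum.\<close>
proof (induction I rule: infinite_finite_induct)
  case (insert i I)
  then show ?case by (simp add: convex_on_add)
qed (simp_all add: convex_on_const)

lemma concave_on_sum_fun:
  assumes "convex S" "\<And>i. i \<in> I \<Longrightarrow> concave_on S (f i)"
  shows "concave_on S (\<lambda>z. \<Sum>i\<in>I. f i z)"
  using convex_on_sum_fun[of S I "\<lambda>i z. - f i z"] assms
  by (simp add: concave_on_def sum_negf)

text \<open>This is the shape of the summands of both rate lower bounds: a constant minus a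
  nonnegative multiple of a squared distance.\<close>

lemma concave_on_distance_bound:
  assumes "affine_map h" "convex S" "0 \<le> c"
  shows "concave_on S (\<lambda>z. - c * ((norm (h z - b))\<^sup>2 - r) + d)"
proof -
  have "convex_on S (\<lambda>z. c * (norm (h z - b))\<^sup>2)"
    by (intro convex_on_cmul convex_on_norm_affine_power2 affine_map_diff affine_map_const assms)
  then have "concave_on S (\<lambda>z. (c * r + d) - c * (norm (h z - b))\<^sup>2)"
    by (intro concave_on_diff) (simp_all add: concave_on_const assms)
  then show ?thesis by (simp add: algebra_simps)
qed

text \<open>A connected set of reals contains everything between two of its points, so points on
  opposite sides of 0 would force 0 into it.\<close>

lemma connected_real_nonzero_same_sign:
  fixes S :: "real set"
  assumes "connected S" "0 \<notin> S" "x \<in> S" "y \<in> S"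
  shows "0 < x * y"
proof (rule ccontr)
  assume "\<not> 0 < x * y"
  then have "x \<le> 0 \<and> 0 \<le> y \<or> y \<le> 0 \<and> 0 \<le> x"
    by (auto simp: zero_less_mult_iff)
  then have "0 \<in> S"
    using assms connectedD_interval by blast
  with assms show False by simp
qed

lemma convex_on_log_one_plus_inverse_square:
  fixes S :: "real set" and \<beta> :: real
  assumes "connected S" "0 \<notin> S" "0 < a" "0 < b" "1 < \<beta>"
  shows "convex_on S (\<lambda>t. log \<beta> (1 + a / (b * t\<^sup>2)))"
proof -
  define c where "c = a / b"
  have c: "0 < c" using assms by (simp add: c_def)
  \<comment> \<open>Since division by 0 yields 0, this holds at \<open>t = 0\<close> too.\<close>
  have pos: "0 < 1 + c / t\<^sup>2" for t
    using c by (simp add: add_pos_nonneg)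
  have "convex_on S (\<lambda>t. ln (1 + c / t\<^sup>2))"
  \<comment> \<open>Convexity follows from a nondecreasing derivative; \<open>f'\<close> is the
    derivative with the inner fractions cleared.\<close>
  proof (rule convex_on_realI[where f' = "\<lambda>t. - 2 * c / (t * (t\<^sup>2 + c))"])
    fix t assume "t \<in> S"
    with assms(2) have t: "t \<noteq> 0" by blast
    have "t\<^sup>2 + c \<noteq> 0"
      using c by (smt (verit) zero_le_power2)
    then have "(0 - c * (2 * t)) / (t\<^sup>2 * t\<^sup>2) / (1 + c / t\<^sup>2) = - 2 * c / (t * (t\<^sup>2 + c))"
      using t by (simp add: divide_simps) (simp add: algebra_simps power2_eq_square power4_eq_xxxx)
    moreover have "((\<lambda>t. ln (1 + c / t\<^sup>2)) has_real_derivative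
        (0 - c * (2 * t)) / (t\<^sup>2 * t\<^sup>2) / (1 + c / t\<^sup>2)) (at t)"
      using t pos[of t] by (auto intro!: derivative_eq_intros)
    ultimately show "((\<lambda>t. ln (1 + c / t\<^sup>2)) has_real_derivative
        - 2 * c / (t * (t\<^sup>2 + c))) (at t)" by simp
  next
    fix x y assume xy: "x \<in> S" "y \<in> S" "x \<le> y"
    have s: "0 < x * y"
      using connected_real_nonzero_same_sign assms xy by blast
    \<comment> \<open>Both t^3 and c t are nondecreasing in t.\<close>
    have "x * (x\<^sup>2 + c) \<le> y * (y\<^sup>2 + c)"
      using add_mono[OF power_mono_odd[of 3 x y] mult_left_mono[OF xy(3), of c]] c xy
      by (simp add: algebra_simps power2_eq_square power3_eq_cube)
    \<comment> \<open>Taking reciprocals reverses the inequality only if both denominators have the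
      same sign; this is where avoiding 0 matters.\<close>
    moreover have "0 < (x * (x\<^sup>2 + c)) * (y * (y\<^sup>2 + c))"
    proof -
      have "0 < (x * y) * ((x\<^sup>2 + c) * (y\<^sup>2 + c))"
        by (rule mult_pos_pos[OF s], rule mult_pos_pos) (use c in \<open>simp_all add: add_nonneg_pos\<close>)
      then show ?thesis by (simp add: mult_ac)
    qed
    ultimately have "2 * c / (y * (y\<^sup>2 + c)) \<le> 2 * c / (x * (x\<^sup>2 + c))"
      using c by (intro divide_left_mono) (auto simp: mult.commute)
    then show "- 2 * c / (x * (x\<^sup>2 + c)) \<le> - 2 * c / (y * (y\<^sup>2 + c))"
      by simp
  qed (fact assms(1))
  then have "convex_on S (\<lambda>t. ln (1 + c / t\<^sup>2) / ln \<beta>)"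
    using assms(5) by (intro convex_on_cdiv) auto
  then show ?thesis by (simp add: log_def c_def)
qed

section \<open>The trajectory problem\<close>

lemma affine_map_pos: "affine_map (pos p n)"
  by (rule affine_map_linear, rule linearI) (auto simp: pos_def)

lemma affine_map_vel: "affine_map (vel p n)"
  by (rule affine_map_linear, rule linearI) (auto simp: vel_def)

lemma affine_map_acc: "affine_map (acc p n)"
  by (rule affine_map_linear, rule linearI) (auto simp: acc_def)

text \<open>The fading vector may vanish, so strict positivity can fail; concavity needs only the
  weak inequality.\<close>

lemma coef_a_nonneg: "valid_data p \<Longrightarrow> 0 \<le> coef_a p m n"
  unfolding coef_a_def valid_data_def
  by (intro divide_nonneg_nonneg mult_nonneg_nonneg add_nonneg_nonneg) auto

lemma coef_c_nonneg: "valid_data p \<Longrightarrow> 0 \<le> coef_c p k n"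
  unfolding coef_c_def valid_data_def
  by (intro divide_nonneg_nonneg mult_nonneg_nonneg add_nonneg_nonneg) auto

lemma concave_on_receive_rate_lb:
  assumes "valid_data p" "convex S"
  shows "concave_on S (receive_rate_lb p n)"
  unfolding receive_rate_lb_def
  by (intro concave_on_sum_fun concave_on_distance_bound affine_map_pos coef_a_nonneg assms)

lemma concave_on_user_rate_lb:
  assumes "valid_data p" "k \<in> {1..num_users p}" "convex S"
  shows "concave_on S (user_rate_lb p k)"
  unfolding user_rate_lb_def
proof (intro concave_on_cmul concave_on_sum_fun concave_on_distance_bound affine_map_pos
    coef_c_nonneg assms)
  \<comment> \<open>Scaling keeps concavity only for nonnegative weights, and the association
    indicators are 0 or 1.\<close>
  fix n assume "n \<in> {1..num_slots p}"
  then have "assoc p k n \<in> {0, 1}" using assms by (simp add: valid_data_def)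
  then show "0 \<le> assoc p k n" by auto
qed simp

lemma convex_on_transmit_rate_ub_user:
  assumes "valid_data p" "convex S"
    and "\<And>z. z \<in> S \<Longrightarrow> pos p n z $ 1 \<noteq> user p k $ 1 \<and> pos p n z $ 2 \<noteq> user p k $ 2"
  shows "convex_on S (transmit_rate_ub_user p k n)"
proof -
  have coord: "convex_on S (\<lambda>z. log 2 (1 + uav_power p * ref_power p
      / (3 * noise_power p * (pos p n z $ i - user p k $ i)\<^sup>2)))"
    if "\<And>z. z \<in> S \<Longrightarrow> pos p n z $ i \<noteq> user p k $ i" for i
  proof (rule convex_on_affine_map_compose[where h = "\<lambda>z. pos p n z $ i - user p k $ i"])
    show aff: "affine_map (\<lambda>z. pos p n z $ i - user p k $ i)"
      by (intro affine_map_diff affine_map_nth affine_map_pos affine_map_const)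
    \<comment> \<open>The image of \<open>S\<close> under the coordinate difference is convex, hence
      connected, and misses 0 by assumption.\<close>
    show "convex_on ((\<lambda>z. pos p n z $ i - user p k $ i) ` S)
        (\<lambda>t. log 2 (1 + uav_power p * ref_power p / (3 * noise_power p * t\<^sup>2)))"
      using assms(1) that
      by (intro convex_on_log_one_plus_inverse_square convex_connected
          convex_affine_map_image aff assms(2)) (auto simp: valid_data_def)
  qed (fact assms(2))
  show ?thesis
    unfolding transmit_rate_ub_user_def
    using assms by (intro convex_on_add convex_on_cmul coord) (auto simp: convex_on_const)
qed

lemma convex_on_transmit_rate_ub:
  assumes "valid_data p" "convex D" "D \<subseteq> rate_domain p" "n \<in> {2..num_slots p}"
  shows "convex_on D (transmit_rate_ub p n)"
  unfolding transmit_rate_ub_def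
proof (rule convex_on_sum_fun[OF assms(2)])
  fix k assume k: "k \<in> {1..num_users p}"
  have "assoc p k n \<in> {0, 1}" using assms k by (simp add: valid_data_def)
  \<comment> \<open>\<open>rate_domain\<close> excludes the poles only for associated users; for the
    others the summand is identically 0, whatever the position.\<close>
  then consider "assoc p k n = 0" | "assoc p k n = 1" by blast
  then show "convex_on D (\<lambda>z. assoc p k n * transmit_rate_ub_user p k n z)"
  proof cases
    case 1
    then show ?thesis by (simp add: convex_on_const assms)
  next
    case 2
    have "convex_on D (transmit_rate_ub_user p k n)"
      using assms k 2
      by (intro convex_on_transmit_rate_ub_user) (auto simp: rate_domain_def)
    with 2 show ?thesis by simp
  qed
qed

theorem theorem1:
  fixes p :: "('n::finite, 'l::finite) uav_data" and D :: "'n vars set"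
  assumes "valid_data p"
    and "convex D" and "D \<subseteq> rate_domain p"
  shows "convex_problem (trajectory_problem p D)"
proof -
  let ?P = "trajectory_problem p D"
  have "concave_on UNIV (objective ?P)"
    unfolding trajectory_problem_def Let_def
    by (auto intro!: concave_on_sum_fun concave_on_user_rate_lb assms)
  \<comment> \<open>In the constraints posed on \<open>D\<close>, the transmit sums start at slot 2
    and end at some n \<le> N, so each index lies in the range covered by
    \<open>rate_domain\<close>.\<close>
  moreover have "\<forall>(S, f, g) \<in> ineq_constraints ?P. convex_on S f \<and> concave_on S g"
    unfolding trajectory_problem_def Let_def
    by (auto simp: convex_on_const concave_on_const assms
        intro!: concave_on_sum_fun convex_on_sum_fun concave_on_user_rate_lb
        concave_on_receive_rate_lb convex_on_transmit_rate_ub convex_on_norm_affine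
        affine_map_diff affine_map_pos affine_map_vel affine_map_acc assms)
  \<comment> \<open>The slot length is fixed data, so the motion equations combine the variables
    with constant coefficients.\<close>
  moreover have "\<forall>(h, h') \<in> eq_constraints ?P. affine_map h \<and> affine_map h'"
    unfolding trajectory_problem_def Let_def
    by (auto intro!: affine_map_add affine_map_scaleR affine_map_const
        affine_map_pos affine_map_vel affine_map_acc)
  ultimately show ?thesis
    unfolding convex_problem_def by blast
qed

end
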